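(* Let $d,d'\ge 2$ be integers. Using one $d$-box and one $d'$-box, Alice and Bob can exactly simulate one $dd'$-box.
   Context: For an integer $d\ge 2$, a $d$-box is the bipartite non-signalling box with inputs $X,Y\in\{0,1\}$ and outputs $a,b\in\{0,\ldots,d-1\}$ with joint output probabilities $p_{ab|XY}=1/d$ if $(b-a)\bmod d=X\cdot Y$ and $p_{ab|XY}=0$ otherwise. Here $X$ (input) and $a$ (output) belong to Alice, $Y$ and $b$ to Bob. Simulation using boxes (no communication): Alice and Bob share resource boxes $1,\ldots,n$ with probabilities $p^{(i)}$, each usable once. A deterministic local strategy of Alice, for a given global input $X$, is an adaptive rule by which she uses each box exactly once at her side: at each step she chooses the next unused box and the input to it as functions of $X$ and of the outputs she has already received; her final output $a$ is a function of $X$ and all outputs received. Thus a record $\alpha=(\alpha_1,\ldots,\alpha_n)$ of her box outputs determines the record $x(\alpha)=(x_1,\ldots,x_n)$ of her box inputs. Bob has a strategy of the same kind, with global input $Y$, records $\beta$ and $y(\beta)$, and final output $b$; the two parties may use the boxes in different orders. The probability of records $(\alpha,\beta)$ is $\prod_{i=1}^n p^{(i)}_{\alpha_i\beta_i|x_i(\alpha)y_i(\beta)}$. The parties may also choose their deterministic strategies according to local and shared random data that is independent of the global inputs. The resource boxes exactly simulate a target box if some such protocol yields, for every pair of global inputs, final outputs distributed exactly as the target box prescribes. *)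

theory Defs
  imports "HOL-Probability.Probability_Mass_Function"
begin

text \<open>
  \<open>box_prob p a b X Y\<close> is the conditional probability $p_{ab|XY}$; only its values on the
  alphabets of the box are meaningful.
\<close>

record box =
  alice_ins :: "nat set"
  bob_ins :: "nat set"
  alice_outs :: "nat set"
  bob_outs :: "nat set"
  box_prob :: "nat \<Rightarrow> nat \<Rightarrow> nat \<Rightarrow> nat \<Rightarrow> real"

definition d_box :: "nat \<Rightarrow> box" where
  "d_box d =
    \<lparr> alice_ins = {0, 1}, bob_ins = {0, 1},
      alice_outs = {0..<d}, bob_outs = {0..<d},
      box_prob = (\<lambda>a b X Y.
        if (int b - int a) mod int d = int X * int Y then 1 / real d else 0) \<rparr>"

text \<open>
  A deterministic local strategy for one fixed global input is a decision tree:
  \<open>Use i x k\<close> feeds \<open>x\<close> into box \<open>i\<close> and, on receiving output \<open>r\<close>, continues with \<open>k r\<close>.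
  Hence the next box, its input and the final output depend exactly on the outputs received
  so far; the dependence on the global input is added in \<open>exactly_simulates\<close>.
\<close>

datatype strategy = Output nat | Use nat nat "nat \<Rightarrow> strategy"

text \<open>
  \<open>valid_strategy ins outs fin s U\<close>: starting with the boxes in \<open>U\<close> unused, \<open>s\<close> uses each of
  them exactly once, with inputs for box \<open>i\<close> in \<open>ins i\<close>, and then ends with an output in \<open>fin\<close>.
\<close>

primrec valid_strategy ::
  "(nat \<Rightarrow> nat set) \<Rightarrow> (nat \<Rightarrow> nat set) \<Rightarrow> nat set \<Rightarrow> strategy \<Rightarrow> nat set \<Rightarrow> bool" where
  "valid_strategy ins outs fin (Output a) U \<longleftrightarrow> U = {} \<and> a \<in> fin"
| "valid_strategy ins outs fin (Use i x k) U \<longleftrightarrow>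
     i \<in> U \<and> x \<in> ins i \<and> (\<forall>r\<in>outs i. valid_strategy ins outs fin (k r) (U - {i}))"

text \<open>
  Records of outputs and inputs are indexed by the box, not by the time of use, so they are
  comparable between parties using the boxes in different orders.
\<close>

primrec input_record :: "strategy \<Rightarrow> (nat \<Rightarrow> nat) \<Rightarrow> nat \<Rightarrow> nat" where
  "input_record (Output a) \<alpha> = (\<lambda>i. undefined)"
| "input_record (Use i x k) \<alpha> = (input_record (k (\<alpha> i)) \<alpha>)(i := x)"

primrec final_output :: "strategy \<Rightarrow> (nat \<Rightarrow> nat) \<Rightarrow> nat" where
  "final_output (Output a) \<alpha> = a"
| "final_output (Use i x k) \<alpha> = final_output (k (\<alpha> i)) \<alpha>"

definition alice_strategy :: "box list \<Rightarrow> box \<Rightarrow> strategy \<Rightarrow> bool" where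
  "alice_strategy rs t s \<longleftrightarrow>
     valid_strategy (\<lambda>i. alice_ins (rs ! i)) (\<lambda>i. alice_outs (rs ! i)) (alice_outs t) s
       {..<length rs}"

definition bob_strategy :: "box list \<Rightarrow> box \<Rightarrow> strategy \<Rightarrow> bool" where
  "bob_strategy rs t s \<longleftrightarrow>
     valid_strategy (\<lambda>i. bob_ins (rs ! i)) (\<lambda>i. bob_outs (rs ! i)) (bob_outs t) s
       {..<length rs}"

definition record_prob ::
  "box list \<Rightarrow> strategy \<Rightarrow> strategy \<Rightarrow> (nat \<Rightarrow> nat) \<Rightarrow> (nat \<Rightarrow> nat) \<Rightarrow> real" where
  "record_prob rs A B \<alpha> \<beta> =
     (\<Prod>i<length rs.
        box_prob (rs ! i) (\<alpha> i) (\<beta> i) (input_record A \<alpha> i) (input_record B \<beta> i))"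

definition output_prob :: "box list \<Rightarrow> strategy \<Rightarrow> strategy \<Rightarrow> nat \<Rightarrow> nat \<Rightarrow> real" where
  "output_prob rs A B a b =
     (\<Sum>\<alpha> \<in> (\<Pi>\<^sub>E i\<in>{..<length rs}. alice_outs (rs ! i)).
      \<Sum>\<beta> \<in> (\<Pi>\<^sub>E i\<in>{..<length rs}. bob_outs (rs ! i)).
        if final_output A \<alpha> = a \<and> final_output B \<beta> = b then record_prob rs A B \<alpha> \<beta> else 0)"

text \<open>
  \<open>S\<close> is the shared randomness, \<open>L\<close> and \<open>R\<close> are the local randomness of Alice and of Bob; the
  three are independent of each other and of the global inputs. Discrete data are fully general:
  for finite alphabets there are only finitely many deterministic strategies up to their
  behaviour on outputs that can occur.
\<close>

definition exactly_simulates :: "box list \<Rightarrow> box \<Rightarrow> bool" where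
  "exactly_simulates rs t \<longleftrightarrow>
     (\<exists>(S :: nat pmf) (L :: nat pmf) (R :: nat pmf)
       (A :: nat \<Rightarrow> nat \<Rightarrow> nat \<Rightarrow> strategy) (B :: nat \<Rightarrow> nat \<Rightarrow> nat \<Rightarrow> strategy).
        (\<forall>s l. \<forall>X\<in>alice_ins t. alice_strategy rs t (A s l X)) \<and>
        (\<forall>s r. \<forall>Y\<in>bob_ins t. bob_strategy rs t (B s r Y)) \<and>
        (\<forall>X\<in>alice_ins t. \<forall>Y\<in>bob_ins t. \<forall>a\<in>alice_outs t. \<forall>b\<in>bob_outs t.
           measure_pmf.expectation (pair_pmf S (pair_pmf L R))
             (\<lambda>(s, l, r). output_prob rs (A s l X) (B s r Y) a b) = box_prob t a b X Y))"

end

(*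
  Write a = a1 + d * a2 and b = b1 + d * b2. Adding X * Y to a adds X * Y to the low digit and
  carries X * Y into the high digit precisely when a1 = d - 1. The carry bit is thus the product
  of Bob's input Y with X * [a1 = d - 1], which Alice knows once the d-box has answered: she uses
  the d-box first, then feeds this bit into the d'-box, while Bob feeds Y into both. No randomness
  is needed.
*)

theory Submission
  imports Defs
begin

text \<open>One shape serves both parties: \<open>f\<close> turns the answer of box 0 into the input
  of box 1. The two answers are read as the low and high digit of the final output.\<close>

definition digit_strategy :: "nat \<Rightarrow> nat \<Rightarrow> (nat \<Rightarrow> nat) \<Rightarrow> strategy" where
  "digit_strategy d x f = Use 0 x (\<lambda>r. Use 1 (f r) (\<lambda>q. Output (r + d * q)))"

lemma digits_bound:
  fixes r q d m :: nat
  assumes "r < d" "q < m"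
  shows "r + d * q < d * m"
proof -
  have "r + d * q < d * Suc q" using assms(1) by simp
  also have "\<dots> \<le> d * m" using assms(2) by (intro mult_le_mono2) simp
  finally show ?thesis .
qed

lemma digits_eq_iff:
  fixes r q d a :: nat
  assumes "r < d"
  shows "r + d * q = a \<longleftrightarrow> r = a mod d \<and> q = a div d"
  using assms by auto

lemma alice_digit_strategy:
  assumes "x \<in> {0, 1}" "\<And>r. f r \<in> {0, 1}"
  shows "alice_strategy [d_box d, d_box m] (d_box (d * m)) (digit_strategy d x f)"
  using assms
  by (auto simp: alice_strategy_def digit_strategy_def d_box_def digits_bound)

lemma bob_digit_strategy:
  assumes "x \<in> {0, 1}" "\<And>r. f r \<in> {0, 1}"
  shows "bob_strategy [d_box d, d_box m] (d_box (d * m)) (digit_strategy d x f)"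
  using assms
  by (auto simp: bob_strategy_def digit_strategy_def d_box_def digits_bound)

lemma final_output_digit_strategy [simp]:
  "final_output (digit_strategy d x f) \<alpha> = \<alpha> 0 + d * \<alpha> 1"
  by (simp add: digit_strategy_def)

lemma input_record_digit_strategy [simp]:
  "input_record (digit_strategy d x f) \<alpha> 0 = x"
  "input_record (digit_strategy d x f) \<alpha> (Suc 0) = f (\<alpha> 0)"
  by (simp_all add: digit_strategy_def)

text \<open>By uniqueness of division with remainder, exactly one record yields the final output
  \<open>a\<close>. The bound on \<open>a\<close> keeps its high digit within the alphabet of the
  second box.\<close>

lemma sum_PiE_digits:
  fixes g :: "(nat \<Rightarrow> nat) \<Rightarrow> real"
  assumes "a < d * m"
  shows "(\<Sum>\<alpha> \<in> (\<Pi>\<^sub>E i\<in>{..<2}. {0..<[d, m] ! i}). if \<alpha> 0 + d * \<alpha> 1 = a then g \<alpha> else 0)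
    = g (\<lambda>i\<in>{..<2}. [a mod d, a div d] ! i)"
proof -
  \<comment> \<open>The restriction makes the record \<open>undefined\<close> off
    \<open>{..<2}\<close>, as membership in the extensional product demands.\<close>
  let ?D = "\<lambda>i\<in>{..<2::nat}. [a mod d, a div d] ! i"
  let ?P = "\<Pi>\<^sub>E i\<in>{..<2}. {0..<[d, m] ! i}"
  have d: "d > 0" using assms by (cases d) auto
  have D: "?D \<in> ?P"
    using assms d by (auto simp: less_2_cases_iff less_mult_imp_div_less mult.commute)
  have eq: "\<alpha> 0 + d * \<alpha> 1 = a \<longleftrightarrow> \<alpha> = ?D" if \<alpha>: "\<alpha> \<in> ?P" for \<alpha>
  proof -
    have "\<alpha> 0 \<in> {0..<[d, m] ! 0}" by (rule PiE_mem[OF \<alpha>]) simp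
    then have "\<alpha> 0 + d * \<alpha> 1 = a \<longleftrightarrow> \<alpha> 0 = a mod d \<and> \<alpha> 1 = a div d"
      by (intro digits_eq_iff) simp
    also have "\<dots> \<longleftrightarrow> (\<forall>i<2. \<alpha> i = ?D i)"
      by (auto simp: less_2_cases_iff)
    also have "\<dots> \<longleftrightarrow> \<alpha> = ?D"
    proof
      assume "\<forall>i<2. \<alpha> i = ?D i"
      then show "\<alpha> = ?D" by (intro PiE_ext[OF \<alpha> D]) simp
    qed simp
    finally show ?thesis .
  qed
  have "(\<Sum>\<alpha>\<in>?P. if \<alpha> 0 + d * \<alpha> 1 = a then g \<alpha> else 0) = (\<Sum>\<alpha>\<in>?P. if \<alpha> = ?D then g \<alpha> else 0)"
    by (intro sum.cong refl) (simp only: eq)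
  also have "\<dots> = g ?D"
    using D by (simp add: sum.delta finite_PiE)
  finally show ?thesis .
qed

text \<open>Each pair of final outputs arises from a single pair of records, so the double sum
  collapses to one product of two box probabilities.\<close>

lemma output_prob_digit_strategy:
  assumes "a < d * m" "b < d * m"
  shows "output_prob [d_box d, d_box m] (digit_strategy d x f) (digit_strategy d y g) a b
    = box_prob (d_box d) (a mod d) (b mod d) x y
      * box_prob (d_box m) (a div d) (b div d) (f (a mod d)) (g (b mod d))"
proof -
  let ?rs = "[d_box d, d_box m]"
  let ?A = "digit_strategy d x f" and ?B = "digit_strategy d y g"
  let ?P = "\<Pi>\<^sub>E i\<in>{..<2}. {0..<[d, m] ! i}"
  have P: "(\<Pi>\<^sub>E i\<in>{..<length ?rs}. alice_outs (?rs ! i)) = ?P"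
    "(\<Pi>\<^sub>E i\<in>{..<length ?rs}. bob_outs (?rs ! i)) = ?P"
    by (auto intro!: PiE_cong simp: d_box_def numeral_2_eq_2 less_Suc_eq)
  \<comment> \<open>The condition on \<open>\<alpha>\<close> moves out of the inner sum, so that
    \<open>sum_PiE_digits\<close> applies to each sum in turn.\<close>
  have "output_prob ?rs ?A ?B a b =
    (\<Sum>\<alpha>\<in>?P. if \<alpha> 0 + d * \<alpha> 1 = a
      then (\<Sum>\<beta>\<in>?P. if \<beta> 0 + d * \<beta> 1 = b then record_prob ?rs ?A ?B \<alpha> \<beta> else 0) else 0)"
    unfolding output_prob_def P by (intro sum.cong refl) simp
  also have "\<dots> = record_prob ?rs ?A ?B
    (\<lambda>i\<in>{..<2}. [a mod d, a div d] ! i) (\<lambda>i\<in>{..<2}. [b mod d, b div d] ! i)"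
    by (simp only: sum_PiE_digits assms)
  also have "\<dots> = box_prob (d_box d) (a mod d) (b mod d) x y
      * box_prob (d_box m) (a div d) (b div d) (f (a mod d)) (g (b mod d))"
    by (simp add: record_prob_def lessThan_Suc)
  finally show ?thesis .
qed

lemma diff_mod_eq_iff:
  fixes a b c m :: nat
  assumes "b < m" "c < m"
  shows "(int b - int a) mod int m = int c \<longleftrightarrow> b = (a + c) mod m"
proof -
  have "(int b - int a) mod int m = int c \<longleftrightarrow> (int b - int a) mod int m = int c mod int m"
    using assms by simp
  also have "\<dots> \<longleftrightarrow> int b mod int m = (int a + int c) mod int m"
    by (simp add: mod_eq_dvd_iff algebra_simps)
  also have "\<dots> \<longleftrightarrow> b mod m = (a + c) mod m"
    by (simp flip: of_nat_add of_nat_mod)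
  finally show ?thesis using assms by simp
qed

lemma box_prob_d_box:
  assumes "2 \<le> m" "b < m" "x \<in> {0, 1}" "y \<in> {0, 1}"
  shows "box_prob (d_box m) a b x y = (if b = (a + x * y) mod m then 1 / real m else 0)"
proof -
  \<comment> \<open>Since \<open>2 \<le> m\<close>, the bit \<open>x * y\<close> is a reduced
    residue, as \<open>diff_mod_eq_iff\<close> requires.\<close>
  have "x * y < m" using assms by auto
  from diff_mod_eq_iff[OF assms(2) this, of a] show ?thesis
    by (simp add: d_box_def)
qed

text \<open>Reduction modulo \<open>d * m\<close> keeps the low digit and reduces the quotient by
  \<open>d\<close> modulo \<open>m\<close>; a bit \<open>c\<close> carries only when the low digit
  is the largest one.\<close>

lemma eq_mod_mult_digits_iff:
  fixes a b c d m :: nat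
  assumes "2 \<le> d" "b < d * m" "c \<le> 1"
  shows "b = (a + c) mod (d * m) \<longleftrightarrow>
    b mod d = (a mod d + c) mod d \<and>
    b div d = (a div d + (if a mod d = d - 1 then c else 0)) mod m"
proof -
  have "Suc (a mod d) = d \<longleftrightarrow> a mod d = d - 1"
    using assms(1) by linarith
  \<comment> \<open>\<open>div_Suc\<close> raises the quotient when \<open>Suc a mod d = 0\<close>,
    and \<open>mod_Suc\<close> reduces this test to \<open>Suc (a mod d) = d\<close>.\<close>
  then have "Suc a div d = a div d + (if a mod d = d - 1 then 1 else 0)"
    by (simp only: div_Suc mod_Suc if_distrib[of "\<lambda>n. n = 0"]) simp
  moreover have "c = 0 \<or> c = 1"
    using assms(3) by linarith
  ultimately have carry: "(a + c) div d = a div d + (if a mod d = d - 1 then c else 0)"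
    by (elim disjE) simp_all
  have "b = (a + c) mod (d * m) \<longleftrightarrow> (a + c) mod d + d * ((a + c) div d mod m) = b"
    unfolding mod_mult2_eq by linarith
  also have "\<dots> \<longleftrightarrow> (a + c) mod d = b mod d \<and> (a + c) div d mod m = b div d"
    using assms(1) by (intro digits_eq_iff) simp
  finally show ?thesis
    unfolding carry mod_add_left_eq by metis
qed

text \<open>The supports of the two small boxes express the two digit conditions, which together are
  the condition of the large box; the weights \<open>1 / d\<close> and \<open>1 / m\<close>
  multiply.\<close>

lemma d_box_mult:
  assumes "2 \<le> d" "2 \<le> m" "b < d * m" "x \<in> {0, 1}" "y \<in> {0, 1}"
  shows "box_prob (d_box d) (a mod d) (b mod d) x y
      * box_prob (d_box m) (a div d) (b div d) (if a mod d = d - 1 then x else 0) y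
    = box_prob (d_box (d * m)) a b x y"
proof -
  let ?c = "if a mod d = d - 1 then x * y else 0"
  let ?P = "b mod d = (a mod d + x * y) mod d"
  let ?Q = "b div d = (a div d + ?c) mod m"
  have "2 \<le> d * m" using mult_le_mono[OF assms(1,2)] by simp
  moreover have "x * y \<le> 1" using assms(4,5) by auto
  ultimately have "box_prob (d_box (d * m)) a b x y = (if ?P \<and> ?Q then 1 / real (d * m) else 0)"
    by (simp only: box_prob_d_box eq_mod_mult_digits_iff assms)
  moreover have "box_prob (d_box d) (a mod d) (b mod d) x y = (if ?P then 1 / real d else 0)"
    using assms(1) by (intro box_prob_d_box assms) simp
  moreover have "box_prob (d_box m) (a div d) (b div d) (if a mod d = d - 1 then x else 0) y
    = (if ?Q then 1 / real m else 0)"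
  proof -
    have "b div d < m" using assms(3) by (simp add: less_mult_imp_div_less mult.commute)
    moreover have "(if a mod d = d - 1 then x else 0) \<in> {0, 1}" using assms(4) by simp
    \<comment> \<open>The carry bit factors into a part depending only on Alice's data and Bob's
      input.\<close>
    moreover have "(if a mod d = d - 1 then x else 0) * y = ?c" by simp
    ultimately show ?thesis by (simp only: box_prob_d_box assms)
  qed
  ultimately show ?thesis
    by (cases ?P; cases ?Q) (simp_all only: if_True if_False simp_thms of_nat_mult
      times_divide_times_eq mult_1 mult_zero_left mult_zero_right)
qed

text \<open>With point masses as all three random sources, the expectation is the value at one
  point; the seed 0 is arbitrary because the strategies ignore it.\<close>

lemma exactly_simulates_deterministicI:
  assumes "\<And>X. X \<in> alice_ins t \<Longrightarrow> alice_strategy rs t (A X)"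
    and "\<And>Y. Y \<in> bob_ins t \<Longrightarrow> bob_strategy rs t (B Y)"
    and "\<And>X Y a b. X \<in> alice_ins t \<Longrightarrow> Y \<in> bob_ins t \<Longrightarrow> a \<in> alice_outs t \<Longrightarrow> b \<in> bob_outs t \<Longrightarrow>
      output_prob rs (A X) (B Y) a b = box_prob t a b X Y"
  shows "exactly_simulates rs t"
  unfolding exactly_simulates_def
  by (rule exI[of _ "return_pmf 0"], rule exI[of _ "return_pmf 0"], rule exI[of _ "return_pmf 0"],
      rule exI[of _ "\<lambda>_ _. A"], rule exI[of _ "\<lambda>_ _. B"]) (simp add: assms)

theorem mainTheorem6:
  fixes d d' :: nat
  assumes "d \<ge> 2" and "d' \<ge> 2"
  shows "exactly_simulates [d_box d, d_box d'] (d_box (d * d'))"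
proof -
  let ?A = "\<lambda>X. digit_strategy d X (\<lambda>r. if r = d - 1 then X else 0)"
  let ?B = "\<lambda>Y. digit_strategy d Y (\<lambda>_. Y)"
  have ins: "alice_ins (d_box m) = {0, 1}" "bob_ins (d_box m) = {0, 1}"
    and outs: "alice_outs (d_box m) = {0..<m}" "bob_outs (d_box m) = {0..<m}" for m
    by (simp_all add: d_box_def)
  show ?thesis
  proof (rule exactly_simulates_deterministicI[where A = ?A and B = ?B], unfold ins outs)
    fix X Y a b :: nat
    assume "X \<in> {0, 1}" "Y \<in> {0, 1}" "a \<in> {0..<d * d'}" "b \<in> {0..<d * d'}"
    then show "output_prob [d_box d, d_box d'] (?A X) (?B Y) a b = box_prob (d_box (d * d')) a b X Y"
      by (simp only: atLeastLessThan_iff output_prob_digit_strategy d_box_mult assms)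
  qed (simp_all add: alice_digit_strategy bob_digit_strategy)
qed

end
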